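(* Let $(a,b)\subseteq\mathbb{R}$ be a bounded interval, let $k$ be a positive integer, let $E_{k}:=\{(i,j)\in\mathbb{Z}^{2}:|j-i|\geq k+1\}$, and let $c:(0,b-a)\to\mathbb{R}$ be a nonincreasing function. Let $u:(a,b)\to\mathbb{Z}$ be a measurable function with finite image, and let $Mu$ be its nondecreasing rearrangement. Then \[ \mathcal{F}(c,E_{k},u)\geq\mathcal{F}(c,E_{k},Mu). \]
   Context: For a measurable $u:(a,b)\to\mathbb{Z}$ with finite image, a symmetric set $E\subseteq\mathbb{Z}^{2}$ and a nonincreasing $c:(0,b-a)\to\mathbb{R}$ (possibly unbounded as $\sigma\to0^+$), define $I(E,u):=\{(x,y)\in(a,b)^{2}:(u(x),u(y))\in E\}$ and $\mathcal{F}(c,E,u):=\iint_{I(E,u)}c(|y-x|)\,dx\,dy$. The nondecreasing rearrangement of $u$ is $Mu:(a,b)\to\mathbb{Z}$, $Mu(x):=\min\{j\in\mathbb{Z}:\operatorname{meas}\{y\in(a,b):u(y)\leq j\}\geq x-a\}$, where $\operatorname{meas}$ is Lebesgue measure. *)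

theory Defs
  imports "HOL-Analysis.Analysis"
begin

definition Iset :: "real \<Rightarrow> real \<Rightarrow> (int \<times> int) set \<Rightarrow> (real \<Rightarrow> int) \<Rightarrow> (real \<times> real) set" where
  "Iset a b E u = {(x, y). x \<in> {a<..<b} \<and> y \<in> {a<..<b} \<and> (u x, u y) \<in> E}"

text \<open>The functional F(c,E,u), the Lebesgue integral of c(|y-x|) over I(E,u), taken in the
extended reals as (integral of positive part) minus (integral of negative part).\<close>
definition Ffun :: "real \<Rightarrow> real \<Rightarrow> (real \<Rightarrow> real) \<Rightarrow> (int \<times> int) set \<Rightarrow> (real \<Rightarrow> int) \<Rightarrow> ereal" where
  "Ffun a b c E u =
     enn2ereal (\<integral>\<^sup>+ p. indicator (Iset a b E u) p * ennreal (c \<bar>snd p - fst p\<bar>) \<partial>(lebesgue \<Otimes>\<^sub>M lebesgue))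
   - enn2ereal (\<integral>\<^sup>+ p. indicator (Iset a b E u) p * ennreal (- c \<bar>snd p - fst p\<bar>) \<partial>(lebesgue \<Otimes>\<^sub>M lebesgue))"

definition Mrearr :: "real \<Rightarrow> real \<Rightarrow> (real \<Rightarrow> int) \<Rightarrow> real \<Rightarrow> int" where
  "Mrearr a b u x = Inf {j::int. measure lebesgue {y \<in> {a<..<b}. u y \<le> j} \<ge> x - a}"

definition Ek :: "nat \<Rightarrow> (int \<times> int) set" where
  "Ek k = {(i, j). \<bar>j - i\<bar> \<ge> int k + 1}"

end

(*
  By the layer-cake formula it suffices to treat c = 1_D with D a lower set of distances (upper sets
  follow by complementation, since u and Mu are equimeasurable). Complementing E_k, one has to show that
  rearranging u increases the measure of the pairs at distance in D whose values differ by at most k.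
  Replacing u by a function that is constant on the cells of a fine grid, this becomes a statement on finite
  sequences (Taylor; Garsia and Rodemich): sorting does not decrease the number of pairs of positions at
  distance at most h whose values differ by at most k. That is shown by removing a maximal entry
  and inducting on the length.
*)

theory Submission
  imports Defs
begin

section \<open>Sorting a finite sequence\<close>

text \<open>Passing to pairs whose values differ by at most \<open>k\<close> is what makes the
  finite problem tractable: all values within \<open>k\<close> of the maximum lie within
  \<open>k\<close> of one another, and nothing similar holds for values far apart. A measurable
  \<open>u\<close> is no step function, and neither \<open>D\<close> nor the jumps of the
  rearrangement respect a grid. The discretisation is therefore exact only up to three small areas:
  pairs with a point outside a compact set on which \<open>u\<close> is uniformly locally constant;
  pairs with a point near one of the finitely many jumps of \<open>Mrearr a b u\<close>, where
  sorting the list and rearranging \<open>u\<close> may disagree; and the four outermost diagonals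
  of cell pairs, at most \<open>4 * N\<close> squares of side \<open>dl\<close>. All three vanish as
  the grid is refined, while the finite inequality carries no error, so the inequality for each
  \<open>D\<close> is exact. As \<open>c\<close> may be unbounded and change sign, both parts of its
  integral may be infinite; each part is compared separately.\<close>

lemma sorted_nth_le_iff:
  fixes xs :: "'a::linorder list"
  assumes "sorted xs" "i < length xs"
  shows "xs ! i \<le> y \<longleftrightarrow> i < length (filter (\<lambda>x. x \<le> y) xs)"
  using assms
proof (induction xs arbitrary: i)
  case (Cons x xs)
  show ?case
  proof (cases "x \<le> y")
    case True
    then show ?thesis using Cons by (cases i) auto
  next
    case False
    have "filter (\<lambda>x. x \<le> y) xs = []" using False Cons.prems by (auto simp: filter_empty_conv)
    moreover have "\<not> (x # xs) ! i \<le> y" using False Cons.prems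
      by (cases i) (auto dest!: nth_mem)
    ultimately show ?thesis using False by simp
  qed
qed simp

definition friends :: "nat \<Rightarrow> nat \<Rightarrow> int list \<Rightarrow> (nat \<times> nat) set" where
  "friends h k xs = {(i, j). i < j \<and> j < length xs \<and> j \<le> i + h \<and> \<bar>xs ! j - xs ! i\<bar> \<le> int k}"

lemma finite_friends [simp]: "finite (friends h k xs)"
  by (rule finite_subset[of _ "{..<length xs} \<times> {..<length xs}"]) (auto simp: friends_def)

text \<open>In a sorted list the entries within \<open>k\<close> of the new maximum fill the last
  positions, and the appended position reaches back over the last \<open>h\<close> positions. So the
  sorted list attains the upper bound of \<open>card_friends_insert_max\<close>.\<close>

lemma card_friends_snoc_max:
  assumes "sorted xs" and "\<And>x. x \<in> set xs \<Longrightarrow> x \<le> m"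
  shows "card (friends h k (xs @ [m])) =
    card (friends h k xs) + min h (length (filter (\<lambda>x. m - int k \<le> x) xs))"
proof -
  define n where "n = length xs"
  define N where "N = length (filter (\<lambda>x. m - int k \<le> x) xs)"
  have "length (filter (\<lambda>x. x \<le> m - int k - 1) xs) + N = n"
  proof -
    have "filter (\<lambda>x. m - int k \<le> x) xs = filter (\<lambda>x. \<not> x \<le> m - int k - 1) xs"
      by (rule filter_cong) auto
    then show ?thesis
      using sum_length_filter_compl[of "\<lambda>x. x \<le> m - int k - 1" xs] by (simp add: N_def n_def)
  qed
  then have N: "m - int k \<le> xs ! i \<longleftrightarrow> n \<le> i + N" if "i < n" for i
    using sorted_nth_le_iff[OF assms(1), of i "m - int k - 1"] that by (auto simp: n_def)
  have le: "xs ! i \<le> m" if "i < n" for i using assms(2) that by (auto simp: n_def)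
  have "N \<le> n" by (simp add: N_def n_def)
  have eq: "friends h k (xs @ [m]) = friends h k xs \<union> (\<lambda>i. (i, n)) ` {n - min h N ..< n}" (is "?A = ?B \<union> ?C")
  proof (intro equalityI subsetI)
    fix p assume "p \<in> ?A"
    then obtain i j where p: "p = (i, j)" "i < j" "j < Suc n" "j \<le> i + h"
      "\<bar>(xs @ [m]) ! j - (xs @ [m]) ! i\<bar> \<le> int k" by (auto simp: friends_def n_def)
    show "p \<in> ?B \<union> ?C"
    proof (cases "j = n")
      case True
      then have "m - int k \<le> xs ! i" using p le[of i] by (auto simp: nth_append n_def)
      then show ?thesis using True p N[of i] by auto
    next
      case False
      then show ?thesis using p by (auto simp: friends_def nth_append n_def)
    qed
  next
    fix p assume "p \<in> ?B \<union> ?C"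
    then show "p \<in> ?A"
    proof
      assume "p \<in> ?C"
      then obtain i where "p = (i, n)" "i < n" "n \<le> i + min h N" using \<open>N \<le> n\<close> by auto
      then show ?thesis using N[of i] le[of i] by (auto simp: friends_def nth_append n_def)
    qed (auto simp: friends_def nth_append n_def)
  qed
  have "card ?A = card ?B + card ?C" unfolding eq
    by (rule card_Un_disjoint) (simp, simp, auto simp: friends_def n_def)
  also have "card ?C = min h N" using \<open>N \<le> n\<close> by (subst card_image) (auto simp: inj_on_def)
  finally show ?thesis by (simp add: N_def)
qed

text \<open>Removing the entry at \<open>p\<close> brings positions on the two sides of \<open>p\<close> closer by one, which creates
  the pairs in \<open>S\<close> below. If \<open>i\<close> and \<open>i + h + 1\<close> both hold friends of the maximum, they
  are friends of each other; hence at most \<open>h\<close> friends of the maximum are lost without compensation.\<close>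
lemma card_friends_insert_max:
  assumes "\<And>x. x \<in> set (ys @ zs) \<Longrightarrow> x \<le> m"
  shows "card (friends h k (ys @ m # zs)) \<le>
    card (friends h k (ys @ zs)) + min h (length (filter (\<lambda>x. m - int k \<le> x) (ys @ zs)))"
proof -
  define p where "p = length ys"
  define xs where "xs = ys @ m # zs"
  define new where "new = ys @ zs"
  \<comment> \<open>\<open>s\<close> sends positions of the shortened list to positions of the full
    one, skipping \<open>p\<close>.\<close>
  define s where "s i = (if i < p then i else Suc i)" for i
  have len: "length xs = Suc (length new)" "p \<le> length new"
    by (auto simp: xs_def new_def p_def)
  have xs_s: "xs ! s i = new ! i" for i
    by (auto simp: xs_def new_def s_def p_def nth_append)
  have xs_p: "xs ! p = m" by (simp add: xs_def p_def)
  have inj_s: "inj s" by (auto simp: inj_def s_def split: if_splits)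
  have surj_s: "\<exists>i < length new. j = s i" if "j < length xs" "j \<noteq> p" for j
    using that len by (intro exI[of _ "if j < p then j else j - 1"]) (auto simp: s_def)
  have le: "xs ! j \<le> m" if "j < length xs" for j
    using that assms by (metis (no_types, lifting) Un_iff insert_iff nth_mem set_append list.simps(15) order_refl xs_def)
  \<comment> \<open>\<open>W\<close> holds the positions of the friends of the entry at
    \<open>p\<close>; since no entry exceeds \<open>m\<close>, a one-sided condition on the value
    suffices.\<close>
  define W where "W = {j. j < length xs \<and> j \<noteq> p \<and> j \<le> p + h \<and> p \<le> j + h \<and> m - int k \<le> xs ! j}"
  define S where "S = {(i, j). i < p \<and> p < j \<and> j < length xs \<and> j = i + Suc h \<and> \<bar>xs ! j - xs ! i\<bar> \<le> int k}"
  define R where "R = {(i, j) \<in> friends h k xs. i \<noteq> p \<and> j \<noteq> p}"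
  have fin: "finite W" "finite R" "finite S"
    unfolding W_def R_def
    apply simp
    apply (rule finite_subset[of _ "friends h k xs"], auto)[1]
    apply (rule finite_subset[of _ "{..<length xs} \<times> {..<length xs}"])
    by (auto simp: S_def)
  have "R \<union> S \<subseteq> map_prod s s ` friends h k new"
  proof
    fix q assume q: "q \<in> R \<union> S"
    then obtain i j where ij: "q = (i, j)" "i < j" "j < length xs" "i \<noteq> p" "j \<noteq> p" by (auto simp: R_def S_def friends_def)
    then obtain i' j' where s: "i = s i'" "j = s j'" "i' < length new" "j' < length new"
      using surj_s[of i] surj_s[of j] by auto
    then have "(i', j') \<in> friends h k new"
      using q ij len by (auto simp: R_def S_def friends_def xs_s) (auto simp: s_def split: if_splits)
    then show "q \<in> map_prod s s ` friends h k new" using s ij by force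
  qed
  then have "card (R \<union> S) \<le> card (map_prod s s ` friends h k new)" by (rule card_mono[rotated]) simp
  also have "\<dots> \<le> card (friends h k new)" by (rule card_image_le) simp
  finally have RS: "card R + card S \<le> card (friends h k new)"
    using fin by (subst (asm) card_Un_disjoint) (auto simp: R_def S_def friends_def)
  have "friends h k xs \<subseteq> R \<union> (\<lambda>j. (min p j, max p j)) ` W"
  proof
    fix q assume q: "q \<in> friends h k xs"
    then obtain i j where ij: "q = (i, j)" "i < j" "j < length xs" by (auto simp: friends_def)
    show "q \<in> R \<union> (\<lambda>j. (min p j, max p j)) ` W"
    proof (cases "i = p \<or> j = p")
      case False
      then show ?thesis using q ij by (auto simp: R_def)
    next
      case True
      then show ?thesis
      proof
        assume "i = p"
        then have "j \<in> W" "q = (min p j, max p j)" using q ij le[of j] xs_p by (auto simp: W_def friends_def)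
        then show ?thesis by blast
      next
        assume "j = p"
        then have "i \<in> W" "q = (min p i, max p i)" using q ij le[of i] xs_p by (auto simp: W_def friends_def)
        then show ?thesis by blast
      qed
    qed
  qed
  then have "card (friends h k xs) \<le> card (R \<union> (\<lambda>j. (min p j, max p j)) ` W)"
    using fin by (intro card_mono) auto
  also have "\<dots> \<le> card R + card ((\<lambda>j. (min p j, max p j)) ` W)" by (rule card_Un_le)
  also have "\<dots> \<le> card R + card W" using card_image_le[OF fin(1)] by simp
  finally have 1: "card (friends h k xs) \<le> card R + card W" .
  have 2: "card W \<le> length (filter (\<lambda>x. m - int k \<le> x) new)"
  proof -
    have "W \<subseteq> s ` {i. i < length new \<and> m - int k \<le> new ! i}"
    proof
      fix j assume j: "j \<in> W"
      then obtain i where "i < length new" "j = s i" using surj_s[of j] by (auto simp: W_def)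
      then show "j \<in> s ` {i. i < length new \<and> m - int k \<le> new ! i}" using j xs_s[of i] by (auto simp: W_def)
    qed
    then have "card W \<le> card (s ` {i. i < length new \<and> m - int k \<le> new ! i})" by (intro card_mono) auto
    also have "\<dots> \<le> card {i. i < length new \<and> m - int k \<le> new ! i}" by (rule card_image_le) auto
    finally show ?thesis by (simp add: length_filter_conv_card)
  qed
  have 3: "card W \<le> h + card S"
  proof -
    \<comment> \<open>Shifting the left half of \<open>W\<close> by \<open>h + 1\<close> moves it
      into the \<open>h\<close> positions after \<open>p\<close>, where the right half
      \<open>B\<close> lies as well. Hence the union has at most \<open>h\<close> elements, and each
      \<open>j\<close> in the overlap gives a pair \<open>(j - Suc h, j)\<close> in
      \<open>S\<close>, because both values lie between \<open>m - k\<close> and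
      \<open>m\<close>.\<close>
    define A where "A = (\<lambda>i. i + Suc h) ` {i \<in> W. i < p}"
    define B where "B = {i \<in> W. p < i}"
    have finAB: "finite A" "finite B" using fin by (auto simp: A_def B_def)
    have "card W = card {i \<in> W. i < p} + card B"
    proof -
      have "W = {i \<in> W. i < p} \<union> B" by (auto simp: B_def W_def)
      then have "card W = card ({i \<in> W. i < p} \<union> B)" by (rule arg_cong)
      also have "\<dots> = card {i \<in> W. i < p} + card B"
        using fin by (intro card_Un_disjoint) (auto simp: B_def)
      finally show ?thesis .
    qed
    also have "card {i \<in> W. i < p} = card A" unfolding A_def by (rule card_image[symmetric]) (auto simp: inj_on_def)
    also have "card A + card B = card (A \<union> B) + card (A \<inter> B)" by (rule card_Un_Int[OF finAB])
    also have "card (A \<union> B) \<le> card {p<..p + h}" by (intro card_mono) (auto simp: A_def B_def W_def)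
    also have "card (A \<inter> B) \<le> card S"
    proof (rule card_inj_on_le[of "\<lambda>j. (j - Suc h, j)"])
      show "(\<lambda>j. (j - Suc h, j)) ` (A \<inter> B) \<subseteq> S"
      proof clarify
        fix j assume "j \<in> A" "j \<in> B"
        then obtain i where i: "j = i + Suc h" "i \<in> W" "i < p" "j \<in> W" "p < j" by (auto simp: A_def B_def)
        then show "(j - Suc h, j) \<in> S" using le[of i] le[of j] by (auto simp: S_def W_def)
      qed
    qed (auto simp: inj_on_def fin)
    finally show ?thesis by simp
  qed
  show ?thesis using 1 2 3 RS by (simp add: xs_def new_def)
qed

text \<open>Deleting a maximal entry costs the sorted list exactly the largest number of pairs that
  it can cost any arrangement: the number of entries within \<open>k\<close> of the maximum depends
  on the multiset only.\<close>

lemma card_friends_le_sort: "card (friends h k xs) \<le> card (friends h k (sort xs))"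
proof (induction "length xs" arbitrary: xs)
  case 0
  then show ?case by simp
next
  case (Suc n)
  define m where "m = Max (set xs)"
  have "xs \<noteq> []" using Suc by auto
  then have m: "m \<in> set xs" "\<And>x. x \<in> set xs \<Longrightarrow> x \<le> m" by (auto simp: m_def)
  then obtain ys zs where xs: "xs = ys @ m # zs" by (meson split_list)
  have "sort xs = sort (ys @ zs) @ [m]"
    by (rule properties_for_sort) (use m xs in \<open>auto simp: sorted_append\<close>)
  moreover have "mset (filter (\<lambda>x. m - int k \<le> x) (sort (ys @ zs))) = mset (filter (\<lambda>x. m - int k \<le> x) (ys @ zs))"
    by simp
  then have "length (filter (\<lambda>x. m - int k \<le> x) (sort (ys @ zs))) = length (filter (\<lambda>x. m - int k \<le> x) (ys @ zs))"
    by (metis mset_eq_length)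
  moreover have "card (friends h k (ys @ zs)) \<le> card (friends h k (sort (ys @ zs)))"
    using Suc xs by auto
  moreover have "card (friends h k xs) \<le>
    card (friends h k (ys @ zs)) + min h (length (filter (\<lambda>x. m - int k \<le> x) (ys @ zs)))"
    unfolding xs by (rule card_friends_insert_max) (use m xs in auto)
  ultimately show ?case using card_friends_snoc_max[of "sort (ys @ zs)" m h k] m xs by auto
qed

section \<open>Level sets and the rearrangement\<close>

lemma sigma_finite_lebesgue: "sigma_finite_measure (lebesgue :: 'a::euclidean_space measure)"
proof
  obtain A :: "'a set set" where A: "countable A" "A \<subseteq> sets lborel" "\<Union>A = space lborel"
    "\<forall>a\<in>A. emeasure lborel a \<noteq> \<infinity>"
    using lborel.sigma_finite_countable by blast
  then show "\<exists>A :: 'a set set. countable A \<and> A \<subseteq> sets lebesgue \<and> \<Union>A = space lebesgue \<and>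
      (\<forall>a\<in>A. emeasure lebesgue a \<noteq> \<infinity>)"
    by (intro exI[of _ A]) (auto simp: subset_iff)
qed

interpretation lebesgue: sigma_finite_measure "lebesgue :: 'a::euclidean_space measure"
  by (rule sigma_finite_lebesgue)

interpretation lebesgue_pair: pair_sigma_finite
  "lebesgue :: 'a::euclidean_space measure" "lebesgue :: 'b::euclidean_space measure" ..

definition cdf :: "real \<Rightarrow> real \<Rightarrow> (real \<Rightarrow> int) \<Rightarrow> int \<Rightarrow> real" where
  "cdf a b u j = measure lebesgue {x \<in> {a<..<b}. u x \<le> j}"

text \<open>Integer bounds and measurable sublevel sets are the properties that pass to the
  rearrangement with the same \<open>lo\<close> and \<open>hi\<close>. The results below thus apply
  to \<open>u\<close>, to \<open>Mrearr a b u\<close> and to the cell index of a grid.\<close>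

locale level_fun =
  fixes a b :: real and u :: "real \<Rightarrow> int" and lo hi :: int
  assumes ab: "a < b"
    and range: "\<And>x. x \<in> {a<..<b} \<Longrightarrow> u x \<in> {lo..hi}"
    and sublevel: "\<And>j. {x \<in> {a<..<b}. u x \<le> j} \<in> sets lebesgue"
begin

definition lvl :: "int \<Rightarrow> real set" where
  "lvl i = {x \<in> {a<..<b}. u x = i}"

lemma lvl_eq: "lvl i = {x \<in> {a<..<b}. u x \<le> i} - {x \<in> {a<..<b}. u x \<le> i - 1}"
  by (auto simp: lvl_def)

lemma lvl_measurable: "lvl i \<in> sets lebesgue"
  unfolding lvl_eq by (intro sets.Diff sublevel)

lemma sublevel_lmeasurable: "{x \<in> {a<..<b}. u x \<le> j} \<in> lmeasurable"
  by (rule fmeasurableI2[of "{a<..<b}"]) (use sublevel in auto)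

lemma emeasure_lvl: "emeasure lebesgue (lvl i) = ennreal (cdf a b u i - cdf a b u (i - 1))"
proof -
  have "lvl i \<in> lmeasurable" unfolding lvl_eq by (intro fmeasurable.Diff sublevel_lmeasurable)
  moreover have "measure lebesgue (lvl i) = cdf a b u i - cdf a b u (i - 1)"
    unfolding lvl_eq cdf_def by (intro measurable_measure_Diff sublevel sublevel_lmeasurable) auto
  ultimately show ?thesis by (simp add: emeasure_eq_measure2)
qed

lemma Iset_eq_UN:
  "Iset a b R u = (\<Union>(i, j) \<in> R \<inter> {lo..hi} \<times> {lo..hi}. lvl i \<times> lvl j)"
  using range by (fastforce simp: Iset_def lvl_def)

lemma Iset_measurable: "Iset a b R u \<in> sets (lebesgue \<Otimes>\<^sub>M lebesgue)"
  unfolding Iset_eq_UN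
  by (intro sets.finite_UN) (auto intro!: pair_measureI lvl_measurable)

text \<open>The right-hand side sees \<open>u\<close> only through its distribution function. This
  yields equimeasurability of \<open>u\<close> and its rearrangement for every relation
  \<open>R\<close>, and later the area of unions of grid squares.\<close>

lemma emeasure_Iset:
  "emeasure (lebesgue \<Otimes>\<^sub>M lebesgue) (Iset a b R u) =
    (\<Sum>(i, j) \<in> R \<inter> {lo..hi} \<times> {lo..hi}.
       ennreal (cdf a b u i - cdf a b u (i - 1)) * ennreal (cdf a b u j - cdf a b u (j - 1)))"
proof -
  let ?B = "\<lambda>(i, j). lvl i \<times> lvl j"
  have "emeasure (lebesgue \<Otimes>\<^sub>M lebesgue) (Iset a b R u) =
    (\<Sum>p \<in> R \<inter> {lo..hi} \<times> {lo..hi}. emeasure (lebesgue \<Otimes>\<^sub>M lebesgue) (?B p))"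
    unfolding Iset_eq_UN
  proof (rule sum_emeasure[symmetric])
    show "?B ` (R \<inter> {lo..hi} \<times> {lo..hi}) \<subseteq> sets (lebesgue \<Otimes>\<^sub>M lebesgue)"
      by (auto intro!: pair_measureI lvl_measurable)
    show "disjoint_family_on ?B (R \<inter> {lo..hi} \<times> {lo..hi})"
      by (auto simp: disjoint_family_on_def lvl_def)
  qed auto
  also have "\<dots> = (\<Sum>(i, j) \<in> R \<inter> {lo..hi} \<times> {lo..hi}.
       ennreal (cdf a b u i - cdf a b u (i - 1)) * ennreal (cdf a b u j - cdf a b u (j - 1)))"
    by (intro sum.cong) (auto simp: lebesgue.emeasure_pair_measure_Times lvl_measurable emeasure_lvl)
  finally show ?thesis .
qed

lemma cdf_nonneg: "0 \<le> cdf a b u j" by (simp add: cdf_def)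

lemma cdf_lt: "cdf a b u j = 0" if "j < lo"
proof -
  have "{x \<in> {a<..<b}. u x \<le> j} = {}" using range that by force
  then show ?thesis unfolding cdf_def by (simp only: measure_empty)
qed

lemma cdf_ge: "cdf a b u j = b - a" if "hi \<le> j"
proof -
  have "{x \<in> {a<..<b}. u x \<le> j} = {a<..<b}" using range that by force
  then show ?thesis using ab unfolding cdf_def by simp
qed

lemma cdf_le: "cdf a b u j \<le> b - a"
proof -
  have "cdf a b u j \<le> measure lebesgue {a<..<b}"
    unfolding cdf_def by (intro measure_mono_fmeasurable sublevel) auto
  then show ?thesis using ab by simp
qed

lemma cdf_mono: "i \<le> j \<Longrightarrow> cdf a b u i \<le> cdf a b u j"
  unfolding cdf_def by (intro measure_mono_fmeasurable sublevel sublevel_lmeasurable) auto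

text \<open>The rearrangement is the generalized inverse of the distribution function. The infimum
  is attained: \<open>hi\<close> belongs to the set, and \<open>lo\<close> bounds it below because
  \<open>cdf\<close> vanishes below \<open>lo\<close> while \<open>x - a\<close> is
  positive.\<close>

lemma Mrearr_le_iff:
  assumes "x \<in> {a<..<b}"
  shows "Mrearr a b u x \<le> j \<longleftrightarrow> x - a \<le> cdf a b u j"
proof -
  let ?S = "{j. x - a \<le> cdf a b u j}"
  have M: "Mrearr a b u x = Inf ?S" by (simp add: Mrearr_def cdf_def)
  have ne: "hi \<in> ?S" using assms cdf_ge[of hi] by auto
  have lb: "lo \<le> j" if "j \<in> ?S" for j
  proof (rule ccontr)
    assume "\<not> lo \<le> j"
    then show False using that assms cdf_lt[of j] by auto
  qed
  have bdd: "bdd_below ?S" using lb by (auto simp: bdd_below_def)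
  have "x - a \<le> cdf a b u j" if "Inf ?S \<le> j"
  proof -
    have "?S \<noteq> {}" using ne by blast
    \<comment> \<open>Over the integers \<open>Inf ?S \<le> j\<close> means
      \<open>Inf ?S < j + 1\<close>, which provides a member of the set at or below
      \<open>j\<close>.\<close>
    from cInf_less_iff[OF this bdd, of "j + 1"] that
    have "\<exists>i\<in>?S. i < j + 1" by linarith
    then obtain i where "i \<in> ?S" "i < j + 1" by blast
    then show ?thesis using cdf_mono[of i j] by simp
  qed
  moreover have "Inf ?S \<le> j" if "x - a \<le> cdf a b u j" using that bdd by (intro cInf_lower) auto
  ultimately show ?thesis unfolding M by blast
qed

lemma sublevel_Mrearr:
  "{x \<in> {a<..<b}. Mrearr a b u x \<le> j} = {a<..<b} \<inter> {..a + cdf a b u j}"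
  using Mrearr_le_iff by (auto simp: algebra_simps)

lemma cdf_Mrearr: "cdf a b (Mrearr a b u) j = cdf a b u j"
proof (cases "cdf a b u j = b - a")
  case True
  then have "{a<..<b} \<inter> {..a + cdf a b u j} = {a<..<b}" by auto
  then have "cdf a b (Mrearr a b u) j = measure lebesgue {a<..<b}"
    unfolding cdf_def[of a b "Mrearr a b u"] sublevel_Mrearr by (rule arg_cong)
  then show ?thesis using ab True by simp
next
  case False
  then have "{a<..<b} \<inter> {..a + cdf a b u j} = {a<..a + cdf a b u j}" using cdf_le[of j] by auto
  then have "cdf a b (Mrearr a b u) j = measure lebesgue {a<..a + cdf a b u j}"
    unfolding cdf_def[of a b "Mrearr a b u"] sublevel_Mrearr by (rule arg_cong)
  then show ?thesis using cdf_nonneg[of j] by simp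
qed

lemma level_fun_Mrearr: "level_fun a b (Mrearr a b u) lo hi"
proof
  show "a < b" by (rule ab)
  show "{x \<in> {a<..<b}. Mrearr a b u x \<le> j} \<in> sets lebesgue" for j
    unfolding sublevel_Mrearr by simp
  show "Mrearr a b u x \<in> {lo..hi}" if "x \<in> {a<..<b}" for x
    using Mrearr_le_iff[OF that, of hi] Mrearr_le_iff[OF that, of "lo - 1"] that
    by (auto simp: cdf_ge cdf_lt)
qed

text \<open>An argument of Lusin type: each of the finitely many level sets is replaced by a closed
  subset, with an equal share of the error \<open>e\<close>. Their union is compact, and
  \<open>u\<close> is continuous on it, hence uniformly continuous.\<close>

lemma uniformly_locally_constant_approx:
  assumes "e > 0"
  obtains K d where "K \<in> sets lebesgue" "K \<subseteq> {a<..<b}" "emeasure lebesgue ({a<..<b} - K) \<le> ennreal e"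
    "d > 0" "\<And>x y. x \<in> K \<Longrightarrow> y \<in> K \<Longrightarrow> \<bar>x - y\<bar> < d \<Longrightarrow> u x = u y"
proof -
  define J where "J = card {lo..hi}"
  have "lo \<le> hi" using range[of "(a + b) / 2"] ab by auto
  then have J: "J > 0" by (simp add: J_def)
  have "\<exists>T. closed T \<and> T \<subseteq> lvl i \<and> emeasure lebesgue (lvl i - T) < ennreal (e / J)" for i
    using sets_lebesgue_inner_closed[OF lvl_measurable[of i], of "e / J"] J assms by (metis divide_pos_pos of_nat_0_less_iff)
  then obtain T where T: "\<And>i. closed (T i)" "\<And>i. T i \<subseteq> lvl i"
    "\<And>i. emeasure lebesgue (lvl i - T i) < ennreal (e / J)" by metis
  define K where "K = (\<Union>i\<in>{lo..hi}. T i)"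
  have K_sub: "K \<subseteq> {a<..<b}"
  proof -
    have "T i \<subseteq> {a<..<b}" for i using T(2)[of i] by (auto simp: lvl_def)
    then show ?thesis unfolding K_def by blast
  qed
  have "closed K" unfolding K_def by (intro closed_UN ballI T(1)) simp
  moreover have "bounded K" by (rule bounded_subset[OF bounded_Ioo K_sub])
  ultimately have "compact K" by (simp add: compact_eq_bounded_closed)
  have closed_meas: "S \<in> sets lebesgue" if "closed S" for S :: "real set"
    by (rule sets_completionI_sets) (simp add: that borel_closed)
  have K_meas: "K \<in> sets lebesgue" by (rule closed_meas) fact
  have diff_meas: "lvl i - T i \<in> sets lebesgue" for i
    by (rule sets.Diff[OF lvl_measurable closed_meas[OF T(1)]])
  have "{a<..<b} - K \<subseteq> (\<Union>i\<in>{lo..hi}. lvl i - T i)" using range by (force simp: K_def lvl_def)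
  then have "emeasure lebesgue ({a<..<b} - K) \<le> emeasure lebesgue (\<Union>i\<in>{lo..hi}. lvl i - T i)"
    using diff_meas by (intro emeasure_mono sets.finite_UN) auto
  also have "\<dots> \<le> (\<Sum>i\<in>{lo..hi}. emeasure lebesgue (lvl i - T i))"
    using diff_meas by (intro emeasure_subadditive_finite) auto
  also have "\<dots> \<le> (\<Sum>i\<in>{lo..hi}. ennreal (e / J))" by (intro sum_mono less_imp_le T(3))
  also have "\<dots> = ennreal (\<Sum>i\<in>{lo..hi}. e / J)" using assms by (intro sum_ennreal) auto
  also have "(\<Sum>i\<in>{lo..hi}. e / J) = e" using J by (simp add: J_def)
  finally have K_small: "emeasure lebesgue ({a<..<b} - K) \<le> ennreal e" .
  have "continuous_on K (\<lambda>x. real_of_int (u x))"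
    unfolding K_def
  proof (rule continuous_on_closed_Union)
    fix i
    show "continuous_on (T i) (\<lambda>x. real_of_int (u x))"
    proof (subst continuous_on_cong[OF refl])
      show "real_of_int (u x) = real_of_int i" if "x \<in> T i" for x
        using T(2)[of i] that by (auto simp: lvl_def)
    qed simp
  qed (simp_all add: T(1))
  then have "uniformly_continuous_on K (\<lambda>x. real_of_int (u x))"
    using \<open>compact K\<close> by (rule compact_uniformly_continuous)
  \<comment> \<open>Tolerance 1 suffices, as integers less than 1 apart coincide.\<close>
  then obtain d where d: "d > 0"
    "\<And>x y. x \<in> K \<Longrightarrow> y \<in> K \<Longrightarrow> dist x y < d \<Longrightarrow> dist (real_of_int (u x)) (real_of_int (u y)) < 1"
    unfolding uniformly_continuous_on_def by (metis zero_less_one)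
  have "u x = u y" if "x \<in> K" "y \<in> K" "\<bar>x - y\<bar> < d" for x y
  proof -
    have "dist x y < d" using that(3) by (simp add: dist_real_def)
    from d(2)[OF that(1,2) this] have "\<bar>real_of_int (u x - u y)\<bar> < 1" by (simp add: dist_real_def)
    then show ?thesis by linarith
  qed
  with d(1) K_meas K_sub K_small show thesis by (intro that)
qed

end

section \<open>Discretisation on a grid\<close>

text \<open>For \<open>x > a\<close> this is the index of the right-closed cell containing
  \<open>x\<close>. With the ceiling, sublevel sets of the index have the form
  \<open>x - a \<le> n * dl\<close>, the same form as those of the rearrangement, so no boundary
  points need separate care.\<close>

definition cell :: "real \<Rightarrow> real \<Rightarrow> real \<Rightarrow> nat" where
  "cell a dl x = nat (\<lceil>(x - a) / dl\<rceil> - 1)"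

lemma cell_less_iff:
  assumes "0 < dl" "a < x"
  shows "cell a dl x < n \<longleftrightarrow> x - a \<le> real n * dl"
proof -
  have "0 < (x - a) / dl" using assms by simp
  then have "cell a dl x < n \<longleftrightarrow> \<lceil>(x - a) / dl\<rceil> \<le> int n" unfolding cell_def by linarith
  also have "\<dots> \<longleftrightarrow> (x - a) / dl \<le> real n" by (simp add: ceiling_le_iff)
  also have "\<dots> \<longleftrightarrow> x - a \<le> real n * dl" using assms(1) by (simp add: divide_le_eq)
  finally show ?thesis .
qed

lemma cell_dist:
  assumes "0 < dl" "a < x" "a < y"
  shows "(\<bar>real (cell a dl y) - real (cell a dl x)\<bar> - 1) * dl < \<bar>y - x\<bar>"
    and "\<bar>y - x\<bar> < (\<bar>real (cell a dl y) - real (cell a dl x)\<bar> + 1) * dl"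
proof -
  have *: "real (cell a dl z) * dl < z - a \<and> z - a \<le> real (cell a dl z) * dl + dl" if "a < z" for z
    using cell_less_iff[OF assms(1) that, of "cell a dl z"] cell_less_iff[OF assms(1) that, of "Suc (cell a dl z)"]
    by (auto simp: algebra_simps)
  have m: "\<bar>real (cell a dl y) - real (cell a dl x)\<bar> * dl = \<bar>real (cell a dl y) * dl - real (cell a dl x) * dl\<bar>"
    using assms(1) by (simp add: abs_mult_pos left_diff_distrib[symmetric])
  show "(\<bar>real (cell a dl y) - real (cell a dl x)\<bar> - 1) * dl < \<bar>y - x\<bar>"
    and "\<bar>y - x\<bar> < (\<bar>real (cell a dl y) - real (cell a dl x)\<bar> + 1) * dl"
    unfolding left_diff_distrib distrib_right m using *[OF assms(2)] *[OF assms(3)] by linarith+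
qed

locale grid =
  fixes a b :: real and N :: nat and dl :: real
  assumes ab: "a < b" and N: "0 < N" and dl: "dl = (b - a) / real N"
begin

lemma dl_pos: "0 < dl" using ab N dl by simp

lemma N_dl: "real N * dl = b - a" using N dl by simp

lemma cell_less_N: "x \<in> {a<..<b} \<Longrightarrow> cell a dl x < N"
  using cell_less_iff[OF dl_pos, of a x N] N_dl by auto

lemma sublevel_cell:
  "{x \<in> {a<..<b}. int (cell a dl x) \<le> j} = {a<..<b} \<inter> {..a + real (nat (j + 1)) * dl}"
proof -
  have "int (cell a dl x) \<le> j \<longleftrightarrow> x \<le> a + real (nat (j + 1)) * dl" if "x \<in> {a<..<b}" for x
  proof -
    have "int (cell a dl x) \<le> j \<longleftrightarrow> cell a dl x < nat (j + 1)" by linarith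
    then show ?thesis using cell_less_iff[OF dl_pos, of a x "nat (j + 1)"] that by auto
  qed
  then show ?thesis by auto
qed

text \<open>Viewed as a level function, the cell index turns sets of cell pairs into instances of
  \<open>Iset\<close>, whose measurability and area are known.\<close>

sublocale cell: level_fun a b "\<lambda>x. int (cell a dl x)" 0 "int N - 1"
proof
  show "int (cell a dl x) \<in> {0..int N - 1}" if "x \<in> {a<..<b}" for x
    using cell_less_N[OF that] by auto
  show "{x \<in> {a<..<b}. int (cell a dl x) \<le> j} \<in> sets lebesgue" for j
    unfolding sublevel_cell by simp
qed (rule ab)

lemma cdf_cell:
  assumes "n \<le> N"
  shows "cdf a b (\<lambda>x. int (cell a dl x)) (int n - 1) = real n * dl"
proof (cases "n = N")
  case True
  then show ?thesis using cell.cdf_ge N_dl by simp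
next
  case False
  have "real n * dl < real N * dl" using False assms dl_pos by simp
  then have "a + real n * dl < b" using N_dl by linarith
  then have "{a<..<b} \<inter> {..a + real n * dl} = {a<..a + real n * dl}" by auto
  then have "cdf a b (\<lambda>x. int (cell a dl x)) (int n - 1) = measure lebesgue {a<..a + real n * dl}"
    unfolding cdf_def sublevel_cell by simp
  then show ?thesis using dl_pos by simp
qed

lemma cdf_cell_diff:
  assumes "i < N"
  shows "cdf a b (\<lambda>x. int (cell a dl x)) (int i) - cdf a b (\<lambda>x. int (cell a dl x)) (int i - 1) = dl"
  using cdf_cell[of i] cdf_cell[of "Suc i"] assms by (simp add: algebra_simps)

definition cells :: "(nat \<times> nat) set \<Rightarrow> (real \<times> real) set" where
  "cells P = {(x, y). x \<in> {a<..<b} \<and> y \<in> {a<..<b} \<and> (cell a dl x, cell a dl y) \<in> P}"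

lemma cells_eq: "cells P = Iset a b (map_prod int int ` P) (\<lambda>x. int (cell a dl x))"
  by (auto simp: cells_def Iset_def)

lemma cells_measurable: "cells P \<in> sets (lebesgue \<Otimes>\<^sub>M lebesgue)"
  unfolding cells_eq by (rule cell.Iset_measurable)

lemma emeasure_cells:
  assumes "P \<subseteq> {..<N} \<times> {..<N}"
  shows "emeasure (lebesgue \<Otimes>\<^sub>M lebesgue) (cells P) = ennreal (real (card P) * dl\<^sup>2)"
proof -
  let ?F = "cdf a b (\<lambda>x. int (cell a dl x))"
  have "map_prod int int ` P \<inter> {0..int N - 1} \<times> {0..int N - 1} = map_prod int int ` P"
    using assms by auto
  then have "emeasure (lebesgue \<Otimes>\<^sub>M lebesgue) (cells P) =
      (\<Sum>(i, j) \<in> map_prod int int ` P. ennreal (?F i - ?F (i - 1)) * ennreal (?F j - ?F (j - 1)))"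
    unfolding cells_eq cell.emeasure_Iset by (simp only:)
  also have "\<dots> = (\<Sum>p \<in> map_prod int int ` P. ennreal (dl\<^sup>2))"
  proof (intro sum.cong refl)
    fix p assume "p \<in> map_prod int int ` P"
    then obtain i j where p: "p = (int i, int j)" "i < N" "j < N" using assms by auto
    show "(case p of (i, j) \<Rightarrow> ennreal (?F i - ?F (i - 1)) * ennreal (?F j - ?F (j - 1))) = ennreal (dl\<^sup>2)"
      using p dl_pos by (simp add: cdf_cell_diff power2_eq_square ennreal_mult)
  qed
  also have "\<dots> = of_nat (card (map_prod int int ` P)) * ennreal (dl\<^sup>2)" by simp
  also have "card (map_prod int int ` P) = card P" by (rule card_image) (auto simp: inj_on_def)
  also have "of_nat (card P) * ennreal (dl\<^sup>2) = ennreal (real (card P) * dl\<^sup>2)"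
    by (simp add: ennreal_mult ennreal_of_nat_eq_real_of_nat)
  finally show ?thesis .
qed

lemma measure_cell_set:
  assumes "A \<subseteq> {..<N}"
  shows "{x \<in> {a<..<b}. cell a dl x \<in> A} \<in> sets lebesgue"
    and "emeasure lebesgue {x \<in> {a<..<b}. cell a dl x \<in> A} = ennreal (real (card A) * dl)"
proof -
  have eq: "{x \<in> {a<..<b}. cell a dl x \<in> A} = (\<Union>i\<in>A. cell.lvl (int i))"
    by (auto simp: cell.lvl_def)
  have fin: "finite A" using assms finite_subset by blast
  show "{x \<in> {a<..<b}. cell a dl x \<in> A} \<in> sets lebesgue"
    unfolding eq by (intro sets.finite_UN fin) (rule cell.lvl_measurable)
  have "emeasure lebesgue {x \<in> {a<..<b}. cell a dl x \<in> A} = (\<Sum>i\<in>A. emeasure lebesgue (cell.lvl (int i)))"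
    unfolding eq
  proof (rule sum_emeasure[symmetric])
    show "(\<lambda>i. cell.lvl (int i)) ` A \<subseteq> sets lebesgue" using cell.lvl_measurable by blast
    show "disjoint_family_on (\<lambda>i. cell.lvl (int i)) A" by (auto simp: disjoint_family_on_def cell.lvl_def)
  qed (rule fin)
  also have "\<dots> = (\<Sum>i\<in>A. ennreal dl)"
    using assms by (intro sum.cong refl) (auto simp: cell.emeasure_lvl cdf_cell_diff)
  also have "\<dots> = ennreal (real (card A) * dl)"
    using dl_pos by (simp add: ennreal_mult ennreal_of_nat_eq_real_of_nat)
  finally show "emeasure lebesgue {x \<in> {a<..<b}. cell a dl x \<in> A} = ennreal (real (card A) * dl)" .
qed

end

text \<open>An exceptional set of points spoils two strips of pairs, one per coordinate, each of
  area at most \<open>(b - a) * e\<close>.\<close>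

lemma emeasure_le_off_small:
  fixes A :: "real set"
  assumes ab: "a < b" and X: "X \<subseteq> Y \<union> A \<times> {a<..<b} \<union> {a<..<b} \<times> A"
    and Y: "Y \<in> sets (lebesgue \<Otimes>\<^sub>M lebesgue)"
    and A: "A \<in> sets lebesgue" "emeasure lebesgue A \<le> ennreal e" "0 \<le> e"
  shows "emeasure (lebesgue \<Otimes>\<^sub>M lebesgue) X \<le> emeasure (lebesgue \<Otimes>\<^sub>M lebesgue) Y + ennreal (2 * (b - a) * e)"
proof -
  let ?L = "lebesgue \<Otimes>\<^sub>M lebesgue :: (real \<times> real) measure"
  have I: "{a<..<b} \<in> sets lebesgue" by simp
  have *: "A \<times> {a<..<b} \<in> sets ?L" "{a<..<b} \<times> A \<in> sets ?L" using A(1) I by (auto intro: pair_measureI)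
  have "emeasure ?L X \<le> emeasure ?L (Y \<union> A \<times> {a<..<b} \<union> {a<..<b} \<times> A)"
    using X Y * by (intro emeasure_mono) auto
  also have "\<dots> \<le> emeasure ?L (Y \<union> A \<times> {a<..<b}) + emeasure ?L ({a<..<b} \<times> A)"
    using Y * by (intro emeasure_subadditive) auto
  also have "\<dots> \<le> emeasure ?L Y + emeasure ?L (A \<times> {a<..<b}) + emeasure ?L ({a<..<b} \<times> A)"
    using Y * by (intro add_right_mono emeasure_subadditive) auto
  also have "\<dots> = emeasure ?L Y + (emeasure lebesgue A * ennreal (b - a) + ennreal (b - a) * emeasure lebesgue A)"
    using ab by (simp add: lebesgue.emeasure_pair_measure_Times[OF A(1) I] lebesgue.emeasure_pair_measure_Times[OF I A(1)] add.assoc)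
  also have "\<dots> \<le> emeasure ?L Y + (ennreal e * ennreal (b - a) + ennreal (b - a) * ennreal e)"
    using A(2) by (intro add_left_mono add_mono mult_right_mono mult_left_mono) auto
  also have "ennreal e * ennreal (b - a) + ennreal (b - a) * ennreal e = ennreal (2 * (b - a) * e)"
    using A(3) ab by (simp add: ennreal_mult[symmetric] ennreal_plus[symmetric] del: ennreal_plus)
  finally show ?thesis .
qed

text \<open>Area counts ordered pairs, including pairs of points in one cell; hence the symmetric
  version of \<open>friends\<close> together with the diagonal.\<close>

definition near :: "nat \<Rightarrow> nat \<Rightarrow> int list \<Rightarrow> (nat \<times> nat) set" where
  "near h k xs = {(i, j). i < length xs \<and> j < length xs \<and> j \<le> i + h \<and> i \<le> j + h \<and> \<bar>xs ! j - xs ! i\<bar> \<le> int k}"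

lemma finite_near [simp]: "finite (near h k xs)"
  by (rule finite_subset[of _ "{..<length xs} \<times> {..<length xs}"]) (auto simp: near_def)

lemma card_near: "card (near h k xs) = length xs + 2 * card (friends h k xs)"
proof -
  have eq: "near h k xs = (\<lambda>i. (i, i)) ` {..<length xs} \<union> (friends h k xs \<union> prod.swap ` friends h k xs)"
  proof (intro equalityI subsetI)
    fix p assume "p \<in> near h k xs"
    then obtain i j where p: "p = (i, j)" "(i, j) \<in> near h k xs" by (cases p) auto
    consider "i = j" | "i < j" | "j < i" by linarith
    then show "p \<in> (\<lambda>i. (i, i)) ` {..<length xs} \<union> (friends h k xs \<union> prod.swap ` friends h k xs)"
    proof cases
      case 1
      then show ?thesis using p by (auto simp: near_def)
    next
      case 2
      then have "p \<in> friends h k xs" using p by (auto simp: near_def friends_def)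
      then show ?thesis by blast
    next
      case 3
      then have "(j, i) \<in> friends h k xs" using p by (auto simp: near_def friends_def)
      then have "prod.swap (j, i) \<in> prod.swap ` friends h k xs" by (rule imageI)
      then show ?thesis using p by simp
    qed
  qed (auto simp: near_def friends_def)
  have "card (near h k xs) = card ((\<lambda>i. (i, i)) ` {..<length xs}) + card (friends h k xs \<union> prod.swap ` friends h k xs)"
    unfolding eq by (rule card_Un_disjoint) (simp, simp, auto simp: friends_def)
  also have "card (friends h k xs \<union> prod.swap ` friends h k xs) = card (friends h k xs) + card (prod.swap ` friends h k xs)"
    by (rule card_Un_disjoint) (simp, simp, auto simp: friends_def)
  also have "card (prod.swap ` friends h k xs) = card (friends h k xs)" by (rule card_image) simp
  also have "card ((\<lambda>i. (i, i)) ` {..<length xs}) = length xs" by (subst card_image) (auto simp: inj_on_def)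
  finally show ?thesis by simp
qed

lemma card_near_le_sort: "card (near h k xs) \<le> card (near h k (sort xs))"
  using card_friends_le_sort[of h k xs] by (simp add: card_near)

text \<open>The pairs left out have \<open>j - i\<close> equal to \<open>h\<close>,
  \<open>h - 1\<close>, \<open>-h\<close> or \<open>1 - h\<close>: four diagonals, each meeting a
  row at most once.\<close>

lemma card_near_boundary:
  "card (near h k xs) \<le> card {(i, j) \<in> near h k xs. j + 2 \<le> i + h \<and> i + 2 \<le> j + h} + 4 * length xs"
proof -
  let ?A = "{(i, j) \<in> near h k xs. j + 2 \<le> i + h \<and> i + 2 \<le> j + h}"
  \<comment> \<open>\<open>f\<close> lists the four candidate columns of a row. Truncated
    subtraction can only add spurious pairs to \<open>?B\<close>, which is harmless for a
    covering.\<close>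
  define f where "f q = (fst q, [fst q + h, fst q + h - 1, fst q - h, fst q + 1 - h] ! snd q)" for q
  let ?B = "f ` ({..<length xs} \<times> {..<4})"
  have "near h k xs \<subseteq> ?A \<union> ?B"
  proof
    fix p assume p: "p \<in> near h k xs"
    obtain i j where ij: "p = (i, j)" by (cases p)
    show "p \<in> ?A \<union> ?B"
    proof (cases "j + 2 \<le> i + h \<and> i + 2 \<le> j + h")
      case True
      then show ?thesis using p ij by auto
    next
      case False
      then have "j = i + h \<or> j = i + h - 1 \<or> j = i - h \<or> j = i + 1 - h" "i < length xs"
        using p ij by (auto simp: near_def)
      then have "p = f (i, 0) \<or> p = f (i, 1) \<or> p = f (i, 2) \<or> p = f (i, 3)"
        unfolding ij f_def by (simp add: numeral_2_eq_2 numeral_3_eq_3)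
      then show ?thesis using \<open>i < length xs\<close> by (elim disjE) (simp_all add: rev_image_eqI)
    qed
  qed
  moreover have fin: "finite ?A" by (rule finite_subset[of _ "near h k xs"]) auto
  ultimately have "card (near h k xs) \<le> card (?A \<union> ?B)" by (intro card_mono) auto
  also have "\<dots> \<le> card ?A + card ?B" by (rule card_Un_le)
  also have "card ?B \<le> card ({..<length xs} \<times> {..<4::nat})" by (rule card_image_le) simp
  finally show ?thesis by simp
qed

section \<open>Step function approximation\<close>

definition band :: "real set \<Rightarrow> (real \<times> real) set" where
  "band D = {p. \<bar>snd p - fst p\<bar> \<in> D}"

lemma borel_measurable_abs_diff:
  "(\<lambda>p. \<bar>snd p - fst p\<bar>) \<in> borel_measurable (lebesgue \<Otimes>\<^sub>M lebesgue :: (real \<times> real) measure)"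
proof -
  have id: "(\<lambda>x. x) \<in> borel_measurable (lebesgue :: real measure)"
    by (intro measurable_completion) simp
  have "fst \<in> borel_measurable (lebesgue \<Otimes>\<^sub>M lebesgue :: (real \<times> real) measure)"
    "snd \<in> borel_measurable (lebesgue \<Otimes>\<^sub>M lebesgue :: (real \<times> real) measure)"
    using measurable_compose[OF measurable_fst id] measurable_compose[OF measurable_snd id] by auto
  then show ?thesis by (intro borel_measurable_abs borel_measurable_diff)
qed

lemma space_lebesgue_pair [simp]: "space (lebesgue \<Otimes>\<^sub>M lebesgue :: (real \<times> real) measure) = UNIV"
  by (simp add: space_pair_measure)

lemma band_measurable:
  assumes "D \<in> sets borel"
  shows "band D \<in> sets (lebesgue \<Otimes>\<^sub>M lebesgue)"
  using measurable_sets[OF borel_measurable_abs_diff assms] by (simp add: band_def vimage_def)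

lemma lower_set_borel:
  fixes D :: "real set"
  assumes "\<And>s r. s \<in> D \<Longrightarrow> r \<le> s \<Longrightarrow> r \<in> D"
  shows "D \<in> sets borel"
  by (rule real_interval_borel_measurable) (use assms in \<open>auto simp: is_interval_1\<close>)

text \<open>\<open>w\<close> has one value per cell and must match \<open>u\<close> only on
  \<open>K\<close>. Its values stay in \<open>{lo..hi}\<close>, the thresholds at which sorted list
  and rearrangement are compared.\<close>

locale grid_approx = level_fun a b u lo hi + grid a b N dl
  for a b :: real and u :: "real \<Rightarrow> int" and lo hi :: int and N :: nat and dl :: real +
  fixes K :: "real set" and w :: "int list" and e :: real
  assumes K_meas: "K \<in> sets lebesgue" and K_sub: "K \<subseteq> {a<..<b}"
    and K_small: "emeasure lebesgue ({a<..<b} - K) \<le> ennreal e" and e_nonneg: "0 \<le> e"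
    and w_length: "length w = N" and w_range: "set w \<subseteq> {lo..hi}"
    and w_cell: "\<And>x. x \<in> K \<Longrightarrow> w ! cell a dl x = u x"
begin

lemma Kc_meas: "{a<..<b} - K \<in> sets lebesgue"
  by (intro sets.Diff K_meas) simp

text \<open>Sublevel sets of \<open>u\<close> and of the step function given by \<open>w\<close>
  differ only outside \<open>K\<close>.\<close>

lemma cdf_approx: "\<bar>cdf a b u j - real (length (filter (\<lambda>x. x \<le> j) w)) * dl\<bar> \<le> e"
proof -
  define I where "I = {i. i < N \<and> w ! i \<le> j}"
  define A where "A = {x \<in> {a<..<b}. cell a dl x \<in> I}"
  define B where "B = {x \<in> {a<..<b}. u x \<le> j}"
  let ?n = "real (length (filter (\<lambda>x. x \<le> j) w))"
  have I: "I \<subseteq> {..<N}" "card I = length (filter (\<lambda>x. x \<le> j) w)"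
    by (auto simp: I_def length_filter_conv_card w_length)
  have A: "A \<in> sets lebesgue" "emeasure lebesgue A = ennreal (?n * dl)"
    using measure_cell_set[OF I(1)] by (auto simp: A_def I(2))
  have B: "B \<in> sets lebesgue" "emeasure lebesgue B = ennreal (cdf a b u j)"
    using sublevel_lmeasurable[of j] by (auto simp: B_def cdf_def sublevel emeasure_eq_measure2)
  have nn: "0 \<le> ?n * dl" "0 \<le> cdf a b u j" using dl_pos cdf_nonneg by auto
  have le: "emeasure lebesgue X \<le> emeasure lebesgue Y + ennreal e"
    if "X \<subseteq> Y \<union> ({a<..<b} - K)" "Y \<in> sets lebesgue" for X Y
  proof -
    have "emeasure lebesgue X \<le> emeasure lebesgue (Y \<union> ({a<..<b} - K))"
      using that Kc_meas by (intro emeasure_mono sets.Un)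
    also have "\<dots> \<le> emeasure lebesgue Y + emeasure lebesgue ({a<..<b} - K)"
      using that Kc_meas by (intro emeasure_subadditive)
    also have "\<dots> \<le> emeasure lebesgue Y + ennreal e" using K_small by (rule add_left_mono)
    finally show ?thesis .
  qed
  have iff: "x \<in> A \<longleftrightarrow> x \<in> B" if "x \<in> K" for x
  proof -
    have "x \<in> {a<..<b}" using that K_sub by blast
    then show ?thesis using w_cell[OF that] cell_less_N[of x] by (simp add: A_def B_def I_def)
  qed
  have "A \<subseteq> {a<..<b}" "B \<subseteq> {a<..<b}" by (auto simp: A_def B_def)
  then have "A \<subseteq> B \<union> ({a<..<b} - K)" "B \<subseteq> A \<union> ({a<..<b} - K)" using iff by blast+
  from le[OF this(1) B(1)] le[OF this(2) A(1)]
  have "?n * dl \<le> cdf a b u j + e" "cdf a b u j \<le> ?n * dl + e"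
    using nn e_nonneg unfolding A(2) B(2)
    by (simp_all add: ennreal_plus[symmetric] del: ennreal_plus)
  then show ?thesis by linarith
qed

text \<open>Windows around the jump points of the rearrangement; by \<open>cdf_approx\<close> they
  also contain those of the sorted step function.\<close>

definition jumps :: "real set" where
  "jumps = (\<Union>j\<in>{lo..hi}. {a + cdf a b u j - e..a + cdf a b u j + e})"

lemma jumps_measurable: "jumps \<in> sets lebesgue"
  unfolding jumps_def by (intro sets.finite_UN) auto

lemma emeasure_jumps: "emeasure lebesgue jumps \<le> ennreal (2 * e * real (card {lo..hi}))"
proof -
  have "emeasure lebesgue jumps \<le> (\<Sum>j\<in>{lo..hi}. emeasure lebesgue {a + cdf a b u j - e..a + cdf a b u j + e})"
    unfolding jumps_def by (intro emeasure_subadditive_finite) auto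
  also have "\<dots> = (\<Sum>j\<in>{lo..hi}. ennreal (2 * e))"
    using e_nonneg by (intro sum.cong) auto
  also have "\<dots> = ennreal (\<Sum>j\<in>{lo..hi}. 2 * e)" using e_nonneg by (intro sum_ennreal) auto
  finally show ?thesis by (simp add: mult.commute)
qed

text \<open>Both sides are generalized inverses, of the counting function of \<open>w\<close> and of
  \<open>cdf\<close>. Outside the windows, \<open>x\<close> lies on the same side of both thresholds
  for each \<open>j\<close> in \<open>{lo..hi}\<close>, and two integers of that range which pass
  the same tests are equal.\<close>

lemma sort_cell_eq_Mrearr:
  assumes x: "x \<in> {a<..<b}" "x \<notin> jumps"
  shows "sort w ! cell a dl x = Mrearr a b u x"
proof -
  let ?n = "\<lambda>j. length (filter (\<lambda>x. x \<le> j) w)"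
  have len: "length (filter (\<lambda>x. x \<le> j) (sort w)) = ?n j" for j
    by (metis mset_eq_length mset_filter mset_sort)
  have i: "cell a dl x < length (sort w)" using cell_less_N[OF x(1)] w_length by simp
  have sort_iff: "sort w ! cell a dl x \<le> j \<longleftrightarrow> x - a \<le> real (?n j) * dl" for j
    using sorted_nth_le_iff[OF _ i, of j] cell_less_iff[OF dl_pos, of a x "?n j"] x(1) by (simp add: len)
  have iff: "sort w ! cell a dl x \<le> j \<longleftrightarrow> Mrearr a b u x \<le> j" if "j \<in> {lo..hi}" for j
  proof -
    have "\<not> \<bar>x - a - cdf a b u j\<bar> \<le> e" using x(2) that unfolding jumps_def abs_le_iff by force
    then show ?thesis
      unfolding sort_iff Mrearr_le_iff[OF x(1)] using cdf_approx[of j] by linarith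
  qed
  have "sort w ! cell a dl x \<in> {lo..hi}"
    using i w_range by (metis nth_mem set_sort subset_iff)
  moreover have "Mrearr a b u x \<in> {lo..hi}"
    using level_fun.range[OF level_fun_Mrearr x(1)] .
  ultimately show ?thesis using iff by (meson order_antisym order_refl)
qed

text \<open>The error terms stem, in this order, from the strips over \<open>jumps\<close>, from the
  four diagonals dropped after sorting (\<open>4 * N\<close> squares of side \<open>dl\<close>, with
  \<open>N * dl = b - a\<close>), and from the strips over the complement of
  \<open>K\<close>.\<close>

lemma emeasure_friends_band_le:
  assumes D: "\<And>s r. s \<in> D \<Longrightarrow> r \<le> s \<Longrightarrow> r \<in> D" and "0 \<in> D"
  shows "emeasure (lebesgue \<Otimes>\<^sub>M lebesgue) (Iset a b {(i, j). \<bar>j - i\<bar> \<le> int k} u \<inter> band D) \<le>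
    emeasure (lebesgue \<Otimes>\<^sub>M lebesgue) (Iset a b {(i, j). \<bar>j - i\<bar> \<le> int k} (Mrearr a b u) \<inter> band D)
    + ennreal (4 * (b - a) * e * real (card {lo..hi}) + 4 * (b - a) * dl + 2 * (b - a) * e)"
proof -
  let ?L = "lebesgue \<Otimes>\<^sub>M lebesgue :: (real \<times> real) measure"
  let ?F = "{(i::int, j). \<bar>j - i\<bar> \<le> int k}"
  let ?M = "Mrearr a b u"
  have lt: "a < b" by (rule level_fun.ab[OF level_fun_Mrearr])
  \<comment> \<open>\<open>h\<close> is the largest cell distance that occurs among points at distance in \<open>D\<close>, so cells at distance
    at most \<open>h - 2\<close> only contain points at distance in \<open>D\<close>.\<close>
  define Q where "Q n \<longleftrightarrow> n \<le> N \<and> (\<exists>d\<in>D. (real n - 1) * dl < d)" for n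
  define h where "h = (GREATEST n. Q n)"
  \<comment> \<open>The subtraction is real: at \<open>n = 0\<close> the bound is
    \<open>-dl\<close>, which lies below the element \<open>0\<close> of \<open>D\<close>.\<close>
  have "Q 0" using \<open>0 \<in> D\<close> dl_pos by (auto simp: Q_def intro!: bexI[of _ 0])
  then have Qh: "Q h" unfolding h_def by (rule GreatestI_nat[where b = N]) (simp add: Q_def)
  have h_max: "n \<le> h" if "Q n" for n
    unfolding h_def using that by (rule Greatest_le_nat[where b = N]) (simp add: Q_def)
  define P' where "P' = {(i, j) \<in> near h k (sort w). j + 2 \<le> i + h \<and> i + 2 \<le> j + h}"
  have near_sub: "near h k w \<subseteq> {..<N} \<times> {..<N}" by (auto simp: near_def w_length)
  have P'_sub: "P' \<subseteq> {..<N} \<times> {..<N}" by (auto simp: P'_def near_def w_length)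
  have 1: "Iset a b ?F u \<inter> band D \<subseteq> cells (near h k w) \<union> ({a<..<b} - K) \<times> {a<..<b} \<union> {a<..<b} \<times> ({a<..<b} - K)"
  proof
    fix p assume p: "p \<in> Iset a b ?F u \<inter> band D"
    then obtain x y where xy: "p = (x, y)" "x \<in> {a<..<b}" "y \<in> {a<..<b}" "\<bar>u y - u x\<bar> \<le> int k" "\<bar>y - x\<bar> \<in> D"
      by (auto simp: Iset_def band_def)
    show "p \<in> cells (near h k w) \<union> ({a<..<b} - K) \<times> {a<..<b} \<union> {a<..<b} \<times> ({a<..<b} - K)"
    proof (cases "x \<in> K \<and> y \<in> K")
      case True
      define i j where "i = cell a dl x" and "j = cell a dl y"
      have ij: "i < N" "j < N" using cell_less_N xy(2,3) by (auto simp: i_def j_def)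
      have "Q (nat \<bar>int j - int i\<bar>)"
        unfolding Q_def
      proof (intro conjI bexI)
        show "nat \<bar>int j - int i\<bar> \<le> N" using ij by linarith
        have "real (nat \<bar>int j - int i\<bar>) = \<bar>real j - real i\<bar>" by simp
        then show "(real (nat \<bar>int j - int i\<bar>) - 1) * dl < \<bar>y - x\<bar>"
          using cell_dist(1)[OF dl_pos, of a x y] xy(2,3) by (simp add: i_def j_def)
      qed fact
      then have "j \<le> i + h" "i \<le> j + h" using h_max by fastforce+
      moreover have "w ! i = u x" "w ! j = u y" using w_cell True by (auto simp: i_def j_def)
      ultimately have "(i, j) \<in> near h k w" using ij xy(4) by (simp add: near_def w_length)
      then show ?thesis using xy by (simp add: cells_def i_def j_def)
    qed (use xy in auto)
  qed
  have 2: "cells P' \<subseteq> (Iset a b ?F ?M \<inter> band D) \<union> jumps \<times> {a<..<b} \<union> {a<..<b} \<times> jumps"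
  proof
    fix p assume "p \<in> cells P'"
    then obtain x y where xy: "p = (x, y)" "x \<in> {a<..<b}" "y \<in> {a<..<b}" "(cell a dl x, cell a dl y) \<in> P'"
      by (auto simp: cells_def)
    show "p \<in> (Iset a b ?F ?M \<inter> band D) \<union> jumps \<times> {a<..<b} \<union> {a<..<b} \<times> jumps"
    proof (cases "x \<in> jumps \<or> y \<in> jumps")
      case False
      obtain d where d: "d \<in> D" "(real h - 1) * dl < d" using Qh by (auto simp: Q_def)
      \<comment> \<open>Cell distance at most \<open>h - 2\<close> keeps the points less than
        \<open>(h - 1) * dl\<close> apart, hence closer than \<open>d\<close>. This is why two
        diagonals on each side are given up.\<close>
      have "\<bar>real (cell a dl y) - real (cell a dl x)\<bar> + 1 \<le> real h - 1"
        using xy(4) unfolding P'_def by auto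
      then have "(\<bar>real (cell a dl y) - real (cell a dl x)\<bar> + 1) * dl \<le> (real h - 1) * dl"
        using dl_pos by (intro mult_right_mono) auto
      then have "\<bar>y - x\<bar> \<le> d" using cell_dist(2)[OF dl_pos, of a x y] xy(2,3) d(2) by auto
      then have "\<bar>y - x\<bar> \<in> D" by (rule D[OF d(1)])
      moreover have "\<bar>?M y - ?M x\<bar> \<le> int k"
        using xy(4) sort_cell_eq_Mrearr[of x] sort_cell_eq_Mrearr[of y] xy(2,3) False
        by (simp add: P'_def near_def)
      ultimately show ?thesis using xy by (simp add: Iset_def band_def)
    qed (use xy in auto)
  qed
  have meas: "Iset a b ?F ?M \<inter> band D \<in> sets ?L"
    using level_fun.Iset_measurable[OF level_fun_Mrearr] band_measurable[OF lower_set_borel[OF D]]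
    by (intro sets.Int)
  have J0: "0 \<le> 2 * e * real (card {lo..hi})" using e_nonneg by simp
  have "card (near h k w) \<le> card P' + 4 * N"
    using card_near_le_sort[of h k w] card_near_boundary[of h k "sort w"] by (simp add: P'_def w_length)
  then have "real (card (near h k w)) * dl\<^sup>2 \<le> real (card P' + 4 * N) * dl\<^sup>2"
    by (intro mult_right_mono) (simp_all only: of_nat_le_iff zero_le_power2)
  also have "\<dots> = real (card P') * dl\<^sup>2 + 4 * (real N * dl) * dl"
    by (simp add: power2_eq_square algebra_simps)
  finally have 3: "real (card (near h k w)) * dl\<^sup>2 \<le> real (card P') * dl\<^sup>2 + 4 * (b - a) * dl"
    unfolding N_dl .
  have "emeasure ?L (Iset a b ?F u \<inter> band D) \<le> emeasure ?L (cells (near h k w)) + ennreal (2 * (b - a) * e)"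
    by (rule emeasure_le_off_small[OF lt 1 cells_measurable Kc_meas K_small e_nonneg])
  also have "\<dots> \<le> ennreal (real (card P') * dl\<^sup>2 + 4 * (b - a) * dl) + ennreal (2 * (b - a) * e)"
    unfolding emeasure_cells[OF near_sub] by (intro add_right_mono ennreal_leI 3)
  also have "\<dots> = emeasure ?L (cells P') + ennreal (4 * (b - a) * dl) + ennreal (2 * (b - a) * e)"
    unfolding emeasure_cells[OF P'_sub] using dl_pos lt by (subst ennreal_plus) auto
  also have "\<dots> \<le> (emeasure ?L (Iset a b ?F ?M \<inter> band D) + ennreal (2 * (b - a) * (2 * e * real (card {lo..hi}))))
      + ennreal (4 * (b - a) * dl) + ennreal (2 * (b - a) * e)"
    by (intro add_right_mono emeasure_le_off_small[OF lt 2 meas jumps_measurable emeasure_jumps J0])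
  also have "\<dots> = emeasure ?L (Iset a b ?F ?M \<inter> band D)
     + ennreal (4 * (b - a) * e * real (card {lo..hi}) + 4 * (b - a) * dl + 2 * (b - a) * e)"
  proof -
    have "X + ennreal A + ennreal B + ennreal C = X + ennreal (A + B + C)"
      if "0 \<le> A" "0 \<le> B" "0 \<le> C" for X A B C
      using that by (simp add: add.assoc)
    moreover have "2 * (b - a) * (2 * e * real (card {lo..hi})) = 4 * (b - a) * e * real (card {lo..hi})"
      by simp
    ultimately show ?thesis using e_nonneg dl_pos lt by simp
  qed
  finally show ?thesis .
qed

end

section \<open>Refining the grid\<close>

context level_fun
begin

lemma friends_band_le_Mrearr:
  assumes D: "\<And>s r. s \<in> D \<Longrightarrow> r \<le> s \<Longrightarrow> r \<in> D"
  shows "emeasure (lebesgue \<Otimes>\<^sub>M lebesgue) (Iset a b {(i, j). \<bar>j - i\<bar> \<le> int k} u \<inter> band D) \<le>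
    emeasure (lebesgue \<Otimes>\<^sub>M lebesgue) (Iset a b {(i, j). \<bar>j - i\<bar> \<le> int k} (Mrearr a b u) \<inter> band D)"
proof (cases "0 \<in> D")
  case False
  \<comment> \<open>A lower set without \<open>0\<close> contains no nonnegative number, hence no
    distance.\<close>
  then have "band D = {}" using D by (force simp: band_def)
  then show ?thesis by simp
next
  case True
  show ?thesis
  proof (rule ennreal_le_epsilon)
    fix e' :: real assume "0 < e'"
    define J where "J = real (card {lo..hi})"
    \<comment> \<open>With \<open>dl < e\<close> the error is at most \<open>C * e\<close>:
      \<open>4 * J\<close> comes from the jumps, and 6 is 4 for the diagonals plus 2 for the
      complement of \<open>K\<close>.\<close>
    define C where "C = (b - a) * (4 * J + 6)"
    have "C > 0" unfolding C_def using ab by (intro mult_pos_pos) (simp_all add: J_def add_nonneg_pos)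
    define e where "e = e' / C"
    have e: "0 < e" "C * e = e'" using \<open>0 < e'\<close> \<open>0 < C\<close> by (simp_all add: e_def)
    obtain K d where K: "K \<in> sets lebesgue" "K \<subseteq> {a<..<b}" "emeasure lebesgue ({a<..<b} - K) \<le> ennreal e"
      and d: "d > 0" "\<And>x y. x \<in> K \<Longrightarrow> y \<in> K \<Longrightarrow> \<bar>x - y\<bar> < d \<Longrightarrow> u x = u y"
      using uniformly_locally_constant_approx[OF e(1)] by metis
    \<comment> \<open>The mesh is below \<open>d\<close>, so that \<open>u\<close> is constant on
      the part of \<open>K\<close> in each cell, and below \<open>e\<close>, so that the diagonals
      fit into the error.\<close>
    obtain N where N: "(b - a) / min e d < real N" using reals_Archimedean2 by blast
    have md: "0 < min e d" using e d by simp
    have "0 < (b - a) / min e d" using ab md by simp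
    then have N0: "0 < N" using N by (metis less_trans of_nat_0_less_iff)
    define dl where "dl = (b - a) / real N"
    have dl_less: "dl < min e d" using N N0 md by (simp add: dl_def divide_less_eq mult.commute del: min_less_iff_conj)
    interpret grid a b N dl by unfold_locales (use ab N0 dl_def in auto)
    \<comment> \<open>The value of \<open>u\<close> at any point of \<open>K\<close> in the cell;
      \<open>lo\<close> is an arbitrary admissible value for cells that miss
      \<open>K\<close>.\<close>
    define f where "f i = (if \<exists>x\<in>K. cell a dl x = i then u (SOME x. x \<in> K \<and> cell a dl x = i) else lo)" for i
    define w where "w = map f [0..<N]"
    have f_cell: "f (cell a dl x) = u x" if x: "x \<in> K" for x
    proof -
      define y where "y = (SOME y. y \<in> K \<and> cell a dl y = cell a dl x)"
      have y: "y \<in> K \<and> cell a dl y = cell a dl x" unfolding y_def by (rule someI[of _ x]) (use x in simp)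
      have "a < x" "a < y" using y x K(2) by (auto simp: subset_iff)
      then have "\<bar>x - y\<bar> < dl" using cell_dist(2)[OF dl_pos, of a y x] y by simp
      then have "u y = u x" using d(2)[of x y] x y dl_less by simp
      then show ?thesis using x by (auto simp: f_def y_def)
    qed
    have lo_hi: "lo \<le> hi" using range[of "(a + b) / 2"] ab by auto
    have f_range: "f i \<in> {lo..hi}" for i
    proof (cases "\<exists>x\<in>K. cell a dl x = i")
      case True
      then obtain x where "x \<in> K" "cell a dl x = i" by blast
      then show ?thesis using f_cell[of x] range[of x] K(2) by auto
    next
      case False
      then show ?thesis using lo_hi by (auto simp: f_def)
    qed
    interpret grid_approx a b u lo hi N dl K w e
    proof unfold_locales
      show "w ! cell a dl x = u x" if "x \<in> K" for x
        using f_cell[OF that] cell_less_N[of x] that K(2) by (auto simp: w_def)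
      show "set w \<subseteq> {lo..hi}" using f_range by (auto simp: w_def)
    qed (use K e in \<open>auto simp: w_def\<close>)
    have "4 * (b - a) * e * J + 4 * (b - a) * dl + 2 * (b - a) * e \<le> 4 * (b - a) * e * J + 4 * (b - a) * e + 2 * (b - a) * e"
      using dl_less ab by simp
    also have "\<dots> = C * e" by (simp add: C_def algebra_simps)
    finally have le: "4 * (b - a) * e * J + 4 * (b - a) * dl + 2 * (b - a) * e \<le> e'" using e by simp
    have "emeasure (lebesgue \<Otimes>\<^sub>M lebesgue) (Iset a b {(i, j). \<bar>j - i\<bar> \<le> int k} u \<inter> band D) \<le>
      emeasure (lebesgue \<Otimes>\<^sub>M lebesgue) (Iset a b {(i, j). \<bar>j - i\<bar> \<le> int k} (Mrearr a b u) \<inter> band D)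
      + ennreal (4 * (b - a) * e * J + 4 * (b - a) * dl + 2 * (b - a) * e)"
      unfolding J_def by (rule emeasure_friends_band_le) (use D True in auto)
    also have "\<dots> \<le> emeasure (lebesgue \<Otimes>\<^sub>M lebesgue) (Iset a b {(i, j). \<bar>j - i\<bar> \<le> int k} (Mrearr a b u) \<inter> band D)
      + ennreal e'"
      by (intro add_left_mono ennreal_leI le)
    finally show "emeasure (lebesgue \<Otimes>\<^sub>M lebesgue) (Iset a b {(i, j). \<bar>j - i\<bar> \<le> int k} u \<inter> band D) \<le>
      emeasure (lebesgue \<Otimes>\<^sub>M lebesgue) (Iset a b {(i, j). \<bar>j - i\<bar> \<le> int k} (Mrearr a b u) \<inter> band D)
      + ennreal e'" .
  qed
qed

section \<open>Complements: from friends to enemies\<close>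

lemma emeasure_Iset_Mrearr:
  "emeasure (lebesgue \<Otimes>\<^sub>M lebesgue) (Iset a b R (Mrearr a b u)) =
   emeasure (lebesgue \<Otimes>\<^sub>M lebesgue) (Iset a b R u)"
  unfolding emeasure_Iset level_fun.emeasure_Iset[OF level_fun_Mrearr] cdf_Mrearr ..

lemma emeasure_box_finite: "emeasure (lebesgue \<Otimes>\<^sub>M lebesgue) ({a<..<b} \<times> {a<..<b}) < \<infinity>"
  using ab by (simp add: lebesgue.emeasure_pair_measure_Times ennreal_mult[symmetric])

lemma emeasure_Iset_finite:
  "emeasure (lebesgue \<Otimes>\<^sub>M lebesgue) (Iset a b R v \<inter> S) \<noteq> \<infinity>"
proof -
  have "emeasure (lebesgue \<Otimes>\<^sub>M lebesgue) (Iset a b R v \<inter> S) \<le> emeasure (lebesgue \<Otimes>\<^sub>M lebesgue) ({a<..<b} \<times> {a<..<b})"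
    by (intro emeasure_mono pair_measureI) (auto simp: Iset_def)
  then show ?thesis using emeasure_box_finite by (auto simp: infinity_ennreal_def dest: neq_top_trans[rotated])
qed

text \<open>The minuend does not depend on \<open>v\<close> and is finite, so the inequality for
  friends reverses for enemies.\<close>

lemma enemies_band_eq:
  assumes "level_fun a b v lo hi" and D: "D \<in> sets borel"
  shows "emeasure (lebesgue \<Otimes>\<^sub>M lebesgue) (Iset a b (Ek k) v \<inter> band D) =
    emeasure (lebesgue \<Otimes>\<^sub>M lebesgue) ({a<..<b} \<times> {a<..<b} \<inter> band D) -
    emeasure (lebesgue \<Otimes>\<^sub>M lebesgue) (Iset a b {(i, j). \<bar>j - i\<bar> \<le> int k} v \<inter> band D)"
proof -
  interpret v: level_fun a b v lo hi by fact
  have eq: "Iset a b (Ek k) v \<inter> band D = ({a<..<b} \<times> {a<..<b} \<inter> band D) - (Iset a b {(i, j). \<bar>j - i\<bar> \<le> int k} v \<inter> band D)"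
    by (auto simp: Iset_def Ek_def)
  have "{a<..<b} \<times> {a<..<b} \<inter> band D \<in> sets (lebesgue \<Otimes>\<^sub>M lebesgue)"
    by (intro sets.Int pair_measureI band_measurable D) auto
  moreover have "Iset a b {(i, j). \<bar>j - i\<bar> \<le> int k} v \<inter> band D \<in> sets (lebesgue \<Otimes>\<^sub>M lebesgue)"
    by (intro sets.Int v.Iset_measurable band_measurable D)
  moreover have "Iset a b {(i, j). \<bar>j - i\<bar> \<le> int k} v \<inter> band D \<subseteq> {a<..<b} \<times> {a<..<b} \<inter> band D"
    by (auto simp: Iset_def)
  ultimately show ?thesis unfolding eq using emeasure_Iset_finite by (intro emeasure_Diff)
qed

lemma enemies_band_lower:
  assumes D: "\<And>s r. s \<in> D \<Longrightarrow> r \<le> s \<Longrightarrow> r \<in> D"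
  shows "emeasure (lebesgue \<Otimes>\<^sub>M lebesgue) (Iset a b (Ek k) (Mrearr a b u) \<inter> band D) \<le>
    emeasure (lebesgue \<Otimes>\<^sub>M lebesgue) (Iset a b (Ek k) u \<inter> band D)"
proof -
  have "D \<in> sets borel" by (rule lower_set_borel, rule D)
  show ?thesis
    unfolding enemies_band_eq[OF level_fun_Mrearr \<open>D \<in> sets borel\<close>]
      enemies_band_eq[OF level_fun_axioms \<open>D \<in> sets borel\<close>]
    by (rule ennreal_mono_minus, rule friends_band_le_Mrearr, rule D)
qed

lemma enemies_off_band_eq:
  assumes "level_fun a b v lo hi" and D: "D \<in> sets borel"
  shows "emeasure (lebesgue \<Otimes>\<^sub>M lebesgue) (Iset a b R v - band D) =
    emeasure (lebesgue \<Otimes>\<^sub>M lebesgue) (Iset a b R v) -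
    emeasure (lebesgue \<Otimes>\<^sub>M lebesgue) (Iset a b R v \<inter> band D)"
proof -
  interpret v: level_fun a b v lo hi by fact
  have eq: "Iset a b R v - band D = Iset a b R v - (Iset a b R v \<inter> band D)" by blast
  have "Iset a b R v \<inter> band D \<in> sets (lebesgue \<Otimes>\<^sub>M lebesgue)"
    by (intro sets.Int v.Iset_measurable band_measurable D)
  then show ?thesis unfolding eq by (rule emeasure_Diff[OF emeasure_Iset_finite v.Iset_measurable _ Int_lower1])
qed

text \<open>Here the complement is taken inside the set of enemy pairs, whose total measure is the
  same for \<open>u\<close> and its rearrangement: fewer pairs in the band leave more outside. This
  serves the negative part of \<open>c\<close>.\<close>

lemma enemies_off_band_lower:
  assumes D: "\<And>s r. s \<in> D \<Longrightarrow> r \<le> s \<Longrightarrow> r \<in> D"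
  shows "emeasure (lebesgue \<Otimes>\<^sub>M lebesgue) (Iset a b (Ek k) u - band D) \<le>
    emeasure (lebesgue \<Otimes>\<^sub>M lebesgue) (Iset a b (Ek k) (Mrearr a b u) - band D)"
proof -
  have "D \<in> sets borel" by (rule lower_set_borel, rule D)
  show ?thesis
    unfolding enemies_off_band_eq[OF level_fun_Mrearr \<open>D \<in> sets borel\<close>]
      enemies_off_band_eq[OF level_fun_axioms \<open>D \<in> sets borel\<close>] emeasure_Iset_Mrearr
    by (rule ennreal_mono_minus, rule enemies_band_lower, rule D)
qed

end

section \<open>From lower sets of distances to monotone kernels\<close>

text \<open>Tonelli for the region under the graph of \<open>f\<close> over \<open>I\<close>. Only
  levels \<open>s \<ge> 0\<close> enter, because \<open>ennreal\<close> truncates \<open>f\<close>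
  to its positive part.\<close>

lemma (in sigma_finite_measure) nn_integral_layer_cake:
  fixes f :: "'a \<Rightarrow> real"
  assumes [measurable]: "I \<in> sets M" "f \<in> borel_measurable M"
  shows "(\<integral>\<^sup>+ p. indicator I p * ennreal (f p) \<partial>M) =
    (\<integral>\<^sup>+ s. indicator {0..} s * emeasure M (I \<inter> {p. s < f p}) \<partial>lborel)"
proof -
  interpret P: pair_sigma_finite M "lborel :: real measure" ..
  define g where "g p s = (indicator {q \<in> space (M \<Otimes>\<^sub>M lborel). fst q \<in> I \<and> 0 \<le> snd q \<and> snd q < f (fst q)} (p, s) :: ennreal)" for p s
  have "(\<integral>\<^sup>+ p. indicator I p * ennreal (f p) \<partial>M) = (\<integral>\<^sup>+ p. (\<integral>\<^sup>+ s. g p s \<partial>lborel) \<partial>M)"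
  proof (rule nn_integral_cong)
    fix p assume p: "p \<in> space M"
    have "(\<integral>\<^sup>+ s. g p s \<partial>lborel) = (\<integral>\<^sup>+ s. indicator I p * indicator {0..<f p} s \<partial>lborel)"
      using p by (intro nn_integral_cong) (auto simp: g_def space_pair_measure split: split_indicator)
    also have "\<dots> = indicator I p * ennreal (f p)"
      by (cases "0 \<le> f p") (auto simp: nn_integral_cmult ennreal_neg)
    finally show "indicator I p * ennreal (f p) = (\<integral>\<^sup>+ s. g p s \<partial>lborel)" by simp
  qed
  also have "\<dots> = (\<integral>\<^sup>+ s. (\<integral>\<^sup>+ p. g p s \<partial>M) \<partial>lborel)"
    by (rule P.Fubini'[symmetric]) (simp add: g_def[abs_def])
  also have "\<dots> = (\<integral>\<^sup>+ s. indicator {0..} s * emeasure M (I \<inter> {p. s < f p}) \<partial>lborel)"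
  proof (rule nn_integral_cong)
    fix s :: real
    have "I \<inter> {p. s < f p} = I \<inter> {p \<in> space M. s < f p}" using sets.sets_into_space[OF assms(1)] by auto
    then have [measurable]: "I \<inter> {p. s < f p} \<in> sets M" by simp
    have "(\<integral>\<^sup>+ p. g p s \<partial>M) = (\<integral>\<^sup>+ p. indicator {0..} s * indicator (I \<inter> {p. s < f p}) p \<partial>M)"
      by (intro nn_integral_cong) (auto simp: g_def space_pair_measure split: split_indicator)
    then show "(\<integral>\<^sup>+ p. g p s \<partial>M) = indicator {0..} s * emeasure M (I \<inter> {p. s < f p})"
      by (simp add: nn_integral_cmult)
  qed
  finally show ?thesis .
qed

lemma (in sigma_finite_measure) nn_integral_indicator_mono_superlevel:
  fixes f :: "'a \<Rightarrow> real"
  assumes "I \<in> sets M" "J \<in> sets M" "f \<in> borel_measurable M"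
    and "\<And>s. 0 \<le> s \<Longrightarrow> emeasure M (I \<inter> {p. s < f p}) \<le> emeasure M (J \<inter> {p. s < f p})"
  shows "(\<integral>\<^sup>+ p. indicator I p * ennreal (f p) \<partial>M) \<le> (\<integral>\<^sup>+ p. indicator J p * ennreal (f p) \<partial>M)"
  using assms by (simp add: nn_integral_layer_cake) (intro nn_integral_mono, auto split: split_indicator)

theorem theorem2p4:
  fixes a b :: real and k :: nat and c :: "real \<Rightarrow> real" and u :: "real \<Rightarrow> int"
  assumes "a < b"
    and "k \<ge> 1"
    and "\<And>s t. 0 < s \<Longrightarrow> s \<le> t \<Longrightarrow> t < b - a \<Longrightarrow> c t \<le> c s"
    and "u \<in> borel_measurable (restrict_space lebesgue {a<..<b})"
    and "finite (u ` {a<..<b})"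
  shows "Ffun a b c (Ek k) u \<ge> Ffun a b c (Ek k) (Mrearr a b u)"
proof -
  let ?L = "lebesgue \<Otimes>\<^sub>M lebesgue :: (real \<times> real) measure"
  let ?M = "Mrearr a b u"
  define lo where "lo = Min (u ` {a<..<b})"
  define hi where "hi = Max (u ` {a<..<b})"
  interpret level_fun a b u lo hi
  proof
    show "u x \<in> {lo..hi}" if "x \<in> {a<..<b}" for x
      using that assms(5) by (auto simp: lo_def hi_def)
    fix j
    have "u -` {..j} \<inter> space (restrict_space lebesgue {a<..<b}) \<in> sets (restrict_space lebesgue {a<..<b})"
      by (rule measurable_sets[OF assms(4)]) simp
    then have "u -` {..j} \<inter> {a<..<b} \<in> sets lebesgue"
      by (auto simp: sets_restrict_space_iff space_restrict_space)
    moreover have "u -` {..j} \<inter> {a<..<b} = {x \<in> {a<..<b}. u x \<le> j}" by auto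
    ultimately show "{x \<in> {a<..<b}. u x \<le> j} \<in> sets lebesgue" by simp
  qed fact
  interpret M: level_fun a b ?M lo hi by (rule level_fun_Mrearr)
  \<comment> \<open>Monotonicity, and with it measurability, of \<open>c\<close> is known only on
    \<open>(0, b - a)\<close>; extension by 0 gives a function that is Borel on the whole
    line.\<close>
  define C where "C d = (if 0 < d \<and> d < b - a then c d else 0)" for d
  have C_borel: "C \<in> borel_measurable borel"
  proof -
    have "mono_on {0<..<b - a} (\<lambda>d. - c d)" using assms(3) by (auto simp: mono_on_def)
    then have "(\<lambda>d. - c d) \<in> borel_measurable (restrict_space borel {0<..<b - a})"
      by (rule borel_measurable_mono_on_fnc)
    then have "c \<in> borel_measurable (restrict_space borel {0<..<b - a})"
      by (simp add: borel_measurable_uminus_eq)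
    then have "(\<lambda>d. if d \<in> {0<..<b - a} then c d else 0) \<in> borel_measurable borel"
      by (subst (asm) measurable_restrict_space_iff[where c = 0]) auto
    then show ?thesis by (simp add: C_def[abs_def])
  qed
  have C_diff: "(\<lambda>p. C \<bar>snd p - fst p\<bar>) \<in> borel_measurable ?L"
    by (rule measurable_compose[OF borel_measurable_abs_diff C_borel])
  \<comment> \<open>Distance 0 does not occur: a point paired with itself has equal values, while
    pairs in \<open>Ek k\<close> have values at least \<open>k + 1\<close> apart.\<close>
  have dist: "0 < \<bar>snd p - fst p\<bar> \<and> \<bar>snd p - fst p\<bar> < b - a" if "p \<in> Iset a b (Ek k) v" for p v
    using that by (auto simp: Iset_def Ek_def)
  have c_C: "indicator (Iset a b (Ek k) v) p * ennreal (c \<bar>snd p - fst p\<bar>) =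
      indicator (Iset a b (Ek k) v) p * ennreal (C \<bar>snd p - fst p\<bar>)"
    "indicator (Iset a b (Ek k) v) p * ennreal (- c \<bar>snd p - fst p\<bar>) =
      indicator (Iset a b (Ek k) v) p * ennreal (- C \<bar>snd p - fst p\<bar>)" for p v
    using dist[of p v] by (auto simp: C_def split: split_indicator)
  have pos: "(\<integral>\<^sup>+ p. indicator (Iset a b (Ek k) ?M) p * ennreal (C \<bar>snd p - fst p\<bar>) \<partial>?L) \<le>
    (\<integral>\<^sup>+ p. indicator (Iset a b (Ek k) u) p * ennreal (C \<bar>snd p - fst p\<bar>) \<partial>?L)"
  proof (rule lebesgue_pair.P.nn_integral_indicator_mono_superlevel[OF M.Iset_measurable Iset_measurable C_diff])
    fix s :: real
    \<comment> \<open>The superlevel set of \<open>c\<close> closed downwards over all reals. On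
      \<open>(0, b - a)\<close> this adds nothing, since \<open>c\<close> is nonincreasing
      there.\<close>
    define D where "D = {d. \<exists>t\<ge>d. 0 < t \<and> t < b - a \<and> s < c t}"
    have "C \<bar>snd p - fst p\<bar> > s \<longleftrightarrow> p \<in> band D" if "p \<in> Iset a b (Ek k) v" for p v
      using dist[OF that] assms(3)[of "\<bar>snd p - fst p\<bar>"] by (force simp: C_def D_def band_def)
    then have "Iset a b (Ek k) v \<inter> {p. s < C \<bar>snd p - fst p\<bar>} = Iset a b (Ek k) v \<inter> band D" for v
      by blast
    moreover have "emeasure ?L (Iset a b (Ek k) ?M \<inter> band D) \<le> emeasure ?L (Iset a b (Ek k) u \<inter> band D)"
      by (rule enemies_band_lower) (auto simp: D_def intro: order_trans)
    ultimately show "emeasure ?L (Iset a b (Ek k) ?M \<inter> {p. s < C \<bar>snd p - fst p\<bar>}) \<le>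
        emeasure ?L (Iset a b (Ek k) u \<inter> {p. s < C \<bar>snd p - fst p\<bar>})"
      by simp
  qed
  have neg: "(\<integral>\<^sup>+ p. indicator (Iset a b (Ek k) u) p * ennreal (- C \<bar>snd p - fst p\<bar>) \<partial>?L) \<le>
    (\<integral>\<^sup>+ p. indicator (Iset a b (Ek k) ?M) p * ennreal (- C \<bar>snd p - fst p\<bar>) \<partial>?L)"
  proof (rule lebesgue_pair.P.nn_integral_indicator_mono_superlevel[OF Iset_measurable M.Iset_measurable borel_measurable_uminus[OF C_diff]])
    fix s :: real
    \<comment> \<open>Superlevel sets of \<open>-c\<close> are upper sets of distances;
      \<open>D\<close> is the lower set generated by the complementary condition, so the pairs off
      its band are the ones to count.\<close>
    define D where "D = {d. \<exists>t\<ge>d. 0 < t \<and> t < b - a \<and> - c t \<le> s}"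
    have "s < - C \<bar>snd p - fst p\<bar> \<longleftrightarrow> p \<notin> band D" if "p \<in> Iset a b (Ek k) v" for p v
      using dist[OF that] assms(3)[of "\<bar>snd p - fst p\<bar>"] by (force simp: C_def D_def band_def)
    then have "Iset a b (Ek k) v \<inter> {p. s < - C \<bar>snd p - fst p\<bar>} = Iset a b (Ek k) v - band D" for v
      by blast
    moreover have "emeasure ?L (Iset a b (Ek k) u - band D) \<le> emeasure ?L (Iset a b (Ek k) ?M - band D)"
      by (rule enemies_off_band_lower) (auto simp: D_def intro: order_trans)
    ultimately show "emeasure ?L (Iset a b (Ek k) u \<inter> {p. s < - C \<bar>snd p - fst p\<bar>}) \<le>
        emeasure ?L (Iset a b (Ek k) ?M \<inter> {p. s < - C \<bar>snd p - fst p\<bar>})"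
      by simp
  qed
  \<comment> \<open>Subtraction on \<open>ereal\<close> is monotone even for \<open>\<infinity> - \<infinity>\<close>, which is \<open>\<infinity>\<close>.\<close>
  show ?thesis
    unfolding Ffun_def c_C by (intro ereal_minus_mono) (use pos neg in \<open>simp_all add: less_eq_ennreal.rep_eq[symmetric]\<close>)
qed

end
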